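(* Let $d\ge 2$ and let $\mathcal{H}=(V,H)$ be a paving simplicial complex of dimension $d$. Then $$\mathrm{Fl}\,\mathcal{H} = P_{\le d-1}(V)\ \cup\ \{A\in P_d(V)\mid A\cup\{p\}\in H \text{ for every } p\in V\setminus A\}\ \cup\ \mathcal{L}^{(1)}_{\mathcal{H}}\ \cup\ \{V\}.$$
   Context: A simplicial complex is a pair $(V,H)$ with $V$ finite nonempty, $H\subseteq 2^V$ containing all singletons and closed under subsets; elements of $H$ are faces, maximal faces are facets, and the dimension is $\max\{|X|:X\in H\}-1$. $P_k(V)$, $P_{\le k}(V)$, $P_{\ge k}(V)$ denote the sets of subsets of $V$ with exactly, at most, at least $k$ elements. A complex of dimension $d$ is paving if $P_{\le d}(V)\subseteq H$. A subset $F\subseteq V$ is a flat if for every $X\in H$ with $X\subseteq F$ and every $p\in V\setminus F$ we have $X\cup\{p\}\in H$; $\mathrm{Fl}\,\mathcal{H}$ is the set of flats. A long hyperplane is an $X\in P_{\ge d+1}(V)$ containing no facet of $\mathcal{H}$; $\mathcal{L}_{\mathcal{H}}$ is the set of long hyperplanes maximal under inclusion, and $\mathcal{L}^{(1)}_{\mathcal{H}} = \{L\in\mathcal{L}_{\mathcal{H}}\cap\mathrm{Fl}\,\mathcal{H} \mid |L\cap L'|\le d-1 \text{ for every } L'\in\mathcal{L}_{\mathcal{H}}\setminus\{L\}\}$. *)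

theory Defs
  imports Main
begin

definition simplicial_complex :: "'a set \<Rightarrow> 'a set set \<Rightarrow> bool" where
  "simplicial_complex V H \<longleftrightarrow>
     finite V \<and> V \<noteq> {} \<and> H \<subseteq> Pow V \<and> (\<forall>v\<in>V. {v} \<in> H) \<and>
     (\<forall>X\<in>H. \<forall>Y. Y \<subseteq> X \<longrightarrow> Y \<in> H)"

definition facets :: "'a set set \<Rightarrow> 'a set set" where
  "facets H = {X \<in> H. \<forall>Y\<in>H. X \<subseteq> Y \<longrightarrow> Y = X}"

text \<open>A simplicial complex contains a singleton, so the maximum below is at least 1 and
  the natural-number subtraction does not truncate.\<close>

definition dimension :: "'a set set \<Rightarrow> nat" where
  "dimension H = Max (card ` H) - 1"

definition subsets_eq :: "nat \<Rightarrow> 'a set \<Rightarrow> 'a set set" where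
  "subsets_eq k V = {X. X \<subseteq> V \<and> card X = k}"

definition subsets_le :: "nat \<Rightarrow> 'a set \<Rightarrow> 'a set set" where
  "subsets_le k V = {X. X \<subseteq> V \<and> card X \<le> k}"

definition subsets_ge :: "nat \<Rightarrow> 'a set \<Rightarrow> 'a set set" where
  "subsets_ge k V = {X. X \<subseteq> V \<and> card X \<ge> k}"

definition paving :: "'a set \<Rightarrow> 'a set set \<Rightarrow> bool" where
  "paving V H \<longleftrightarrow> subsets_le (dimension H) V \<subseteq> H"

definition flats :: "'a set \<Rightarrow> 'a set set \<Rightarrow> 'a set set" where
  "flats V H = {F. F \<subseteq> V \<and> (\<forall>X\<in>H. X \<subseteq> F \<longrightarrow> (\<forall>p\<in>V - F. X \<union> {p} \<in> H))}"

definition long_hyperplanes :: "'a set \<Rightarrow> 'a set set \<Rightarrow> 'a set set" where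
  "long_hyperplanes V H =
     {X \<in> subsets_ge (dimension H + 1) V. \<not> (\<exists>Y\<in>facets H. Y \<subseteq> X)}"

definition max_long_hyperplanes :: "'a set \<Rightarrow> 'a set set \<Rightarrow> 'a set set" where
  "max_long_hyperplanes V H =
     {L \<in> long_hyperplanes V H. \<forall>L'\<in>long_hyperplanes V H. L \<subseteq> L' \<longrightarrow> L' = L}"

text \<open>The set \<open>\<L>\<^bsup>(1)\<^esup>\<close>.  The subtraction truncates only in dimension 0.\<close>

definition max_long_hyperplanes1 :: "'a set \<Rightarrow> 'a set set \<Rightarrow> 'a set set" where
  "max_long_hyperplanes1 V H =
     {L \<in> max_long_hyperplanes V H \<inter> flats V H.
        \<forall>L'\<in>max_long_hyperplanes V H - {L}. card (L \<inter> L') \<le> dimension H - 1}"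

end

theory Submission
  imports Defs
begin

text \<open>All sets with at most \<open>d\<close> elements are faces and the faces with \<open>d + 1\<close> elements are
  facets. So if \<open>F\<close> is a flat and a set \<open>L\<close> meets \<open>F\<close> in at least \<open>d\<close> points without being
  contained in it, then \<open>d\<close> common points and one point of \<open>L - F\<close> form a facet inside \<open>L\<close>.
  For a flat \<open>F\<close> with more than \<open>d\<close> elements this gives both the maximality of \<open>F\<close> among the
  long hyperplanes and the bound on its intersections with the others.\<close>

lemma card_face_le:
  assumes "simplicial_complex V H" and "X \<in> H"
  shows "card X \<le> dimension H + 1"
proof -
  have "finite H"
    using assms(1) unfolding simplicial_complex_def
    by (meson finite_Pow_iff finite_subset)
  then have "card X \<le> Max (card ` H)"
    using assms(2) by simp
  then show ?thesis
    \<comment> \<open>The truncated subtraction is harmless here: \<open>m \<le> m - 1 + 1\<close>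
      for every natural number \<open>m\<close>.\<close>
    unfolding dimension_def by simp
qed

text \<open>A face of the largest possible size leaves no room for a bigger face above it.\<close>

lemma facet_if_card_eq:
  assumes "simplicial_complex V H" and "X \<in> H" and "card X = dimension H + 1"
  shows "X \<in> facets H"
proof -
  have "Y = X" if "Y \<in> H" "X \<subseteq> Y" for Y
  proof -
    have "finite Y"
      using assms(1) that(1) unfolding simplicial_complex_def
      by (meson PowD finite_subset subsetD)
    then show ?thesis
      using card_face_le[OF assms(1) that(1)] assms(3) that(2)
      by (metis card_seteq)
  qed
  then show ?thesis
    using assms(2) unfolding facets_def by blast
qed

lemma face_if_card_le_dimension:
  assumes "paving V H" and "X \<subseteq> V" and "card X \<le> dimension H"
  shows "X \<in> H"
  using assms unfolding paving_def subsets_le_def by (simp add: subset_eq)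

lemma facet_subset_if_meets_flat:
  assumes sc: "simplicial_complex V H" and pv: "paving V H"
    and F: "F \<in> flats V H" and L: "L \<subseteq> V" "\<not> L \<subseteq> F"
    and card: "dimension H \<le> card (F \<inter> L)"
  obtains Y where "Y \<in> facets H" "Y \<subseteq> L"
proof -
  obtain p where p: "p \<in> L" "p \<notin> F"
    using L(2) by blast
  obtain X where X: "X \<subseteq> F \<inter> L" "card X = dimension H" "finite X"
    using card by (rule obtain_subset_with_card_n)
  have "X \<in> H"
    using face_if_card_le_dimension[OF pv, of X] X(1,2) L(1) by auto
  then have "X \<union> {p} \<in> H"
    using F X(1) p L(1) unfolding flats_def by blast
  moreover have "card (X \<union> {p}) = dimension H + 1"
    using X p by (auto simp: card_insert_if)
  ultimately have "X \<union> {p} \<in> facets H"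
    by (rule facet_if_card_eq[OF sc])
  then show ?thesis
    using that X(1) p(1) by blast
qed

text \<open>A flat lets every face inside it grow by any outside point, and
  \<open>F \<noteq> V\<close> supplies such a point; a facet cannot grow.\<close>

lemma facet_not_subset_flat:
  assumes "F \<in> flats V H" and "F \<noteq> V" and "Y \<in> facets H"
  shows "\<not> Y \<subseteq> F"
proof
  assume "Y \<subseteq> F"
  obtain p where "p \<in> V - F"
    using assms(1,2) unfolding flats_def by blast
  with \<open>Y \<subseteq> F\<close> assms(1,3) have "Y \<union> {p} \<in> H"
    unfolding flats_def facets_def by blast
  then have "Y \<union> {p} = Y"
    using assms(3) unfolding facets_def by blast
  then show False
    using \<open>Y \<subseteq> F\<close> \<open>p \<in> V - F\<close> by blast
qed

lemma large_flat_in_max_long_hyperplanes1: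
  assumes sc: "simplicial_complex V H" and pv: "paving V H"
    and F: "F \<in> flats V H" "F \<noteq> V" and card: "dimension H < card F"
  shows "F \<in> max_long_hyperplanes1 V H"
proof -
  have long: "F \<in> long_hyperplanes V H"
    using F card facet_not_subset_flat[OF F]
    unfolding long_hyperplanes_def subsets_ge_def flats_def by auto
  \<comment> \<open>A long hyperplane contains no facet, so it cannot meet \<open>F\<close> in
    \<open>dimension H\<close> points and also leave \<open>F\<close>.\<close>
  have inter: "L \<subseteq> F" if L: "L \<in> long_hyperplanes V H" "dimension H \<le> card (F \<inter> L)" for L
  proof (rule ccontr)
    assume "\<not> L \<subseteq> F"
    moreover have "L \<subseteq> V"
      using L(1) by (simp add: long_hyperplanes_def subsets_ge_def)
    ultimately obtain Y where "Y \<in> facets H" "Y \<subseteq> L"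
      using facet_subset_if_meets_flat[OF sc pv F(1)] L(2) by metis
    then show False
      using L(1) by (auto simp: long_hyperplanes_def)
  qed
  \<comment> \<open>Here \<open>F \<inter> L = F\<close> is large enough for \<open>inter\<close>,
    which gives the reverse inclusion.\<close>
  have "L = F" if "L \<in> long_hyperplanes V H" "F \<subseteq> L" for L
    using inter[OF that(1)] that(2) card by (simp add: Int_absorb2)
  then have "F \<in> max_long_hyperplanes V H"
    using long unfolding max_long_hyperplanes_def by blast
  moreover have "card (F \<inter> L) \<le> dimension H - 1"
    if "L \<in> max_long_hyperplanes V H" "L \<noteq> F" for L
  proof -
    \<comment> \<open>Since \<open>F\<close> is long, \<open>L \<subseteq> F\<close> would
      contradict the maximality of \<open>L\<close>.\<close>
    have "\<not> L \<subseteq> F" "L \<in> long_hyperplanes V H"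
      using that long unfolding max_long_hyperplanes_def by blast+
    then show ?thesis
      using inter[of L] by linarith
  qed
  ultimately show ?thesis
    using F(1) unfolding max_long_hyperplanes1_def by blast
qed

text \<open>A subset of \<open>F\<close> with one more point has at most \<open>dimension H\<close>
  elements, so paving makes it a face.\<close>

lemma flat_if_card_lt_dimension:
  assumes "paving V H" and "F \<subseteq> V" and "finite F" and "card F < dimension H"
  shows "F \<in> flats V H"
proof -
  have "X \<union> {p} \<in> H" if "X \<subseteq> F" "p \<in> V - F" for X p
  proof -
    have "card (X \<union> {p}) \<le> dimension H"
      using card_mono[OF assms(3) that(1)] assms(4) card_insert_le_m1[of "dimension H" X p]
      by simp
    moreover have "X \<union> {p} \<subseteq> V"
      using assms(2) that by auto
    ultimately show ?thesis
      using face_if_card_le_dimension[OF assms(1)] by simp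
  qed
  then show ?thesis
    using assms(2) unfolding flats_def by blast
qed

text \<open>Faces are closed under subsets, so extending all of \<open>A\<close> by \<open>p\<close>
  settles every smaller \<open>X\<close> at once.\<close>

lemma flat_if_extensions_faces:
  assumes "simplicial_complex V H" and "A \<subseteq> V" and "\<forall>p\<in>V - A. A \<union> {p} \<in> H"
  shows "A \<in> flats V H"
proof -
  have "X \<union> {p} \<in> H" if "X \<subseteq> A" "p \<in> V - A" for X p
  proof -
    have "A \<union> {p} \<in> H" "X \<union> {p} \<subseteq> A \<union> {p}"
      using assms(3) that by auto
    then show ?thesis
      using assms(1) unfolding simplicial_complex_def by blast
  qed
  then show ?thesis
    using assms(2) unfolding flats_def by blast
qed

theorem theorem5p6:
  fixes V :: "'a set" and H :: "'a set set" and d :: nat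
  assumes "d \<ge> 2"
    and "simplicial_complex V H"
    and "dimension H = d"
    and "paving V H"
  shows "flats V H =
    subsets_le (d - 1) V
    \<union> {A \<in> subsets_eq d V. \<forall>p\<in>V - A. A \<union> {p} \<in> H}
    \<union> max_long_hyperplanes1 V H
    \<union> {V}" (is "_ = ?R")
proof (intro equalityI subsetI)
  fix F assume F: "F \<in> flats V H"
  then have "F \<subseteq> V"
    unfolding flats_def by blast
  consider "card F \<le> d - 1" | "card F = d" | "d < card F"
    by linarith
  then show "F \<in> ?R"
  proof cases
    case 1
    then show ?thesis
      using \<open>F \<subseteq> V\<close> by (simp add: subsets_le_def)
  next
    case 2
    \<comment> \<open>By paving \<open>F\<close> is itself a face, so the flat condition applies
      with \<open>X = F\<close>.\<close>
    then have "F \<in> H"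
      using face_if_card_le_dimension[OF assms(4) \<open>F \<subseteq> V\<close>] assms(3) by simp
    then have "\<forall>p\<in>V - F. F \<union> {p} \<in> H"
      using F unfolding flats_def by blast
    then show ?thesis
      using 2 \<open>F \<subseteq> V\<close> by (simp add: subsets_eq_def)
  next
    case 3
    then show ?thesis
      using large_flat_in_max_long_hyperplanes1[OF assms(2,4) F] assms(3) by blast
  qed
next
  fix F assume "F \<in> ?R"
  then consider "F \<subseteq> V" "card F \<le> d - 1" | "F \<subseteq> V" "\<forall>p\<in>V - F. F \<union> {p} \<in> H"
    | "F \<in> max_long_hyperplanes1 V H" | "F = V"
    by (auto simp: subsets_le_def subsets_eq_def)
  then show "F \<in> flats V H"
  proof cases
    case 1
    have "finite F"
      using 1(1) assms(2) by (auto simp: simplicial_complex_def intro: finite_subset)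
    \<comment> \<open>As \<open>d\<close> is positive, \<open>card F \<le> d - 1\<close> really
      means \<open>card F < d\<close>.\<close>
    then show ?thesis
      using flat_if_card_lt_dimension[OF assms(4)] 1 assms(1,3) by simp
  next
    case 2
    then show ?thesis
      by (rule flat_if_extensions_faces[OF assms(2)])
  next
    case 3
    then show ?thesis
      unfolding max_long_hyperplanes1_def by blast
  next
    case 4
    then show ?thesis
      unfolding flats_def by blast
  qed
qed

end
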